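(* Let $K\in\mathbb N$ and let $G:[0,\infty)\to\mathbb R^{K\times K}$ be a decay kernel. The following conditions are equivalent. (a) $\mathbb E[C_{\mathbb T}(\boldsymbol\eta)]\ge0$ for all time grids $\mathbb T$, all initial portfolios $X_0\in\mathbb R^K$, and all $\boldsymbol\eta\in\mathscr X(\mathbb T,X_0)$. (b) $C_{\mathbb T}(\boldsymbol\xi)\ge0$ for all time grids $\mathbb T$ and all $\boldsymbol\xi\in\mathbb R^{|\mathbb T|}\otimes\mathbb R^K$. (c) For all time grids $\mathbb T$, the function $C_{\mathbb T}:\mathbb R^{|\mathbb T|}\otimes\mathbb R^K\to\mathbb R$ is convex. (d) $\widetilde G$ is a positive definite matrix-valued function. If moreover these equivalent conditions are satisfied, then the following holds: for all time grids $\mathbb T$ the equality $C_{\mathbb T}(\boldsymbol\xi)=0$ holds only for $\boldsymbol\xi=\boldsymbol 0$, if and only if $\widetilde G$ is strictly positive definite. In this case, $C_{\mathbb T}:\mathbb R^{|\mathbb T|}\otimes\mathbb R^K\to\mathbb R$ is strictly convex for all time grids $\mathbb T$.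
   Context: A decay kernel is a continuous function $G:[0,\infty)\to\mathbb R^{K\times K}$. Its extension $\widetilde G:\mathbb R\to\mathbb R^{K\times K}$ is $\widetilde G(t)=G(t)$ for $t>0$, $\widetilde G(0)=\frac12(G(0)^\top+G(0))$, $\widetilde G(t)=G(-t)^\top$ for $t<0$. A time grid is a finite set $\mathbb T=\{t_1,\dots,t_N\}$, $N\in\mathbb N$, with $0=t_1<t_2<\dots<t_N$; $|\mathbb T|=N$. Elements of $\mathbb R^N\otimes\mathbb R^K$ are identified with $N$-tuples $\boldsymbol\xi=(\xi_1,\dots,\xi_N)$ of vectors in $\mathbb R^K$. The cost function is $C_{\mathbb T}(\boldsymbol\xi)=\frac12\sum_{k,\ell=1}^N\xi_k^\top\widetilde G(t_k-t_\ell)\xi_\ell$. Let $(\Omega,\mathscr F,(\mathscr F_t)_{t\in[0,T]},\mathbb P)$ be a filtered probability space, with the convention $\mathscr F_t=\mathscr F_T$ for $t>T$. For $X_0\in\mathbb R^K$, $\mathscr X(\mathbb T,X_0)$ is the set of $\boldsymbol\xi=(\xi_1,\dots,\xi_N)$ such that each $\xi_k$ is a bounded $\mathscr F_{t_k}$-measurable $\mathbb R^K$-valued random variable and $X_0+\sum_{k=1}^N\xi_k=0$ $\mathbb P$-a.s. A function $H:\mathbb R\to\mathbb C^{K\times K}$ is a positive definite matrix-valued function if $\sum_{i,j=1}^N z_i^*H(t_i-t_j)z_j\ge0$ for all $N\in\mathbb N$, $t_1,\dots,t_N\in\mathbb R$, $z_1,\dots,z_N\in\mathbb C^K$ ($^*$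 denotes conjugate transpose). It is strictly positive definite if, in addition, for pairwise distinct $t_1,\dots,t_N$ equality holds only when $z_1=\dots=z_N=0$. *)

theory Defs
  imports
    "HOL-Analysis.Analysis"
    "HOL-Analysis.Finite_Function_Topology"
    "HOL-Probability.Probability"
begin


text \<open>Only the values on \<open>[0, \<infinity>)\<close> are relevant; the values of \<open>G\<close> at negative arguments are never used.\<close>

definition decay_kernel :: "(real \<Rightarrow> real^'k^'k) \<Rightarrow> bool"
  where "decay_kernel G \<longleftrightarrow> continuous_on {0..} G"

definition kernel_ext :: "(real \<Rightarrow> real^'k^'k) \<Rightarrow> real \<Rightarrow> real^'k^'k"
  where "kernel_ext G t =
    (if t > 0 then G t
     else if t = 0 then (1/2) *\<^sub>R (transpose (G 0) + G 0)
     else transpose (G (- t)))"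

definition time_grid :: "real set \<Rightarrow> bool"
  where "time_grid \<T> \<longleftrightarrow> finite \<T> \<and> 0 \<in> \<T> \<and> (\<forall>t\<in>\<T>. 0 \<le> t)"

text \<open>The points of a grid in increasing order, with indices \<open>0, \<dots>, N - 1\<close> instead of
  \<open>1, \<dots>, N\<close>; in particular \<open>grid_point \<T> 0 = 0\<close>.\<close>

definition grid_point :: "real set \<Rightarrow> nat \<Rightarrow> real"
  where "grid_point \<T> k = sorted_list_of_set \<T> ! k"

text \<open>The space \<open>\<real>\<^sup>N \<otimes> \<real>\<^sup>K\<close> of \<open>N\<close>-tuples of vectors. Since \<open>N\<close> varies with the grid, a tuple is a
  finitely supported sequence that vanishes from index \<open>N\<close> on; this makes the space a linear
  subspace of a real vector space, so that convexity of functions on it can be expressed by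
  \<^const>\<open>convex_on\<close>.\<close>

definition tuples :: "nat \<Rightarrow> (nat \<Rightarrow>\<^sub>0 real^'k) set"
  where "tuples N = {\<xi>. Poly_Mapping.keys \<xi> \<subseteq> {..<N}}"

definition cost :: "(real \<Rightarrow> real^'k^'k) \<Rightarrow> real set \<Rightarrow> (nat \<Rightarrow>\<^sub>0 real^'k) \<Rightarrow> real"
  where "cost G \<T> \<xi> = 1/2 * (\<Sum>k<card \<T>. \<Sum>l<card \<T>.
    Poly_Mapping.lookup \<xi> k \<bullet>
      (kernel_ext G (grid_point \<T> k - grid_point \<T> l) *v Poly_Mapping.lookup \<xi> l))"

text \<open>A filtration indexed by \<open>[0, T]\<close>; \<open>F t\<close> is unconstrained for \<open>t\<close> outside this interval.\<close>

locale filtered_prob_space = prob_space M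
  for M :: "'w measure" and T :: real and F :: "real \<Rightarrow> 'w measure" +
  assumes horizon_nonneg: "0 \<le> T"
    and subalgebra_filtration: "t \<in> {0..T} \<Longrightarrow> subalgebra M (F t)"
    and filtration_mono: "0 \<le> s \<Longrightarrow> s \<le> t \<Longrightarrow> t \<le> T \<Longrightarrow> sets (F s) \<subseteq> sets (F t)"

text \<open>The convention \<open>F t = F T\<close> for \<open>t > T\<close> is built in through \<open>F (min t T)\<close>.\<close>

definition admissible ::
  "'w measure \<Rightarrow> real \<Rightarrow> (real \<Rightarrow> 'w measure) \<Rightarrow> real set \<Rightarrow> real^'k \<Rightarrow> ('w \<Rightarrow> nat \<Rightarrow>\<^sub>0 real^'k) set"
  where "admissible M T F \<T> X0 =
    {\<eta>. (\<forall>\<omega>\<in>space M. \<eta> \<omega> \<in> tuples (card \<T>)) \<and>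
        (\<forall>k<card \<T>.
          (\<lambda>\<omega>. Poly_Mapping.lookup (\<eta> \<omega>) k) \<in> borel_measurable (F (min (grid_point \<T> k) T)) \<and>
          bounded ((\<lambda>\<omega>. Poly_Mapping.lookup (\<eta> \<omega>) k) ` space M)) \<and>
        (AE \<omega> in M. X0 + (\<Sum>k<card \<T>. Poly_Mapping.lookup (\<eta> \<omega>) k) = 0)}"

definition strictly_convex_on :: "'a::real_vector set \<Rightarrow> ('a \<Rightarrow> real) \<Rightarrow> bool"
  where "strictly_convex_on S f \<longleftrightarrow> convex S \<and>
    (\<forall>x\<in>S. \<forall>y\<in>S. \<forall>u>0. \<forall>v>0. u + v = 1 \<longrightarrow> x \<noteq> y \<longrightarrow>
      f (u *\<^sub>R x + v *\<^sub>R y) < u * f x + v * f y)"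

text \<open>The product \<open>z\<^sup>* A w\<close>, where \<open>z\<^sup>*\<close> is the conjugate transpose.\<close>

definition herm_prod :: "complex^'k \<Rightarrow> complex^'k^'k \<Rightarrow> complex^'k \<Rightarrow> complex"
  where "herm_prod z A w = (\<Sum>a\<in>UNIV. cnj (z $ a) * (A *v w) $ a)"

text \<open>Membership in \<open>\<real>\<^sub>\<ge>\<^sub>0\<close> says that the complex number is real and nonnegative.\<close>

definition pos_def_matrix_fun :: "(real \<Rightarrow> complex^'k^'k) \<Rightarrow> bool"
  where "pos_def_matrix_fun H \<longleftrightarrow>
    (\<forall>N (t :: nat \<Rightarrow> real) z.
      (\<Sum>i<N. \<Sum>j<N. herm_prod (z i) (H (t i - t j)) (z j)) \<in> \<real>\<^sub>\<ge>\<^sub>0)"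

definition strictly_pos_def_matrix_fun :: "(real \<Rightarrow> complex^'k^'k) \<Rightarrow> bool"
  where "strictly_pos_def_matrix_fun H \<longleftrightarrow> pos_def_matrix_fun H \<and>
    (\<forall>N (t :: nat \<Rightarrow> real) z. inj_on t {..<N} \<longrightarrow>
      (\<Sum>i<N. \<Sum>j<N. herm_prod (z i) (H (t i - t j)) (z j)) = 0 \<longrightarrow> (\<forall>i<N. z i = 0))"

definition complexify :: "(real \<Rightarrow> real^'k^'k) \<Rightarrow> real \<Rightarrow> complex^'k^'k"
  where "complexify H t = map_matrix complex_of_real (H t)"

end

theory Submission
  imports Defs
begin

text \<open>Up to the factor \<open>1/2\<close>, the cost function is the real quadratic form of the extended kernel
  at the grid points. Merging repeated points (adding up their vectors), translating to nonnegative
  points and adjoining \<open>0\<close> with the zero vector reduces arbitrary points to a grid. Since the extension satisfies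
  \<open>H (- t) = (H t)\<^sup>T\<close>, the Hermitian form at \<open>z = x + \<i> y\<close> is the real form at \<open>x\<close> plus the real form
  at \<open>y\<close>. Convexity is the identity \<open>q (u x + v y) = u q x + v q y - u v q (x - y)\<close> for \<open>u + v = 1\<close>,
  and (a) is tested on deterministic strategies.\<close>

section \<open>Bilinear forms and convexity of quadratic functions\<close>

definition kernel_form ::
  "(real \<Rightarrow> real^'k^'k) \<Rightarrow> nat \<Rightarrow> (nat \<Rightarrow> real) \<Rightarrow> (nat \<Rightarrow> real^'k) \<Rightarrow> (nat \<Rightarrow> real^'k) \<Rightarrow> real"
  where "kernel_form H N t x y = (\<Sum>i<N. \<Sum>j<N. x i \<bullet> (H (t i - t j) *v y j))"

text \<open>This isolates the one property of a quadratic form that convexity depends on: the gap in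
  the convexity inequality is \<open>u * v * q (x - y)\<close>.\<close>

definition quadratic_defect :: "'a::real_vector set \<Rightarrow> ('a \<Rightarrow> real) \<Rightarrow> bool"
  where "quadratic_defect S q \<longleftrightarrow> (\<forall>x\<in>S. \<forall>y\<in>S. \<forall>u v. u + v = 1 \<longrightarrow>
    q (u *\<^sub>R x + v *\<^sub>R y) = u * q x + v * q y - u * v * q (x - y))"

text \<open>Between \<open>x\<close> and \<open>0\<close> with weights \<open>1/2\<close> the
  convexity gap is \<open>q x / 4\<close>, so convexity forces \<open>q x\<close> to be nonnegative.
  Conversely \<open>x - y\<close> stays in the subspace, so every gap is nonnegative.\<close>

lemma convex_on_iff_nonneg:
  assumes S: "subspace S" and q: "quadratic_defect S q"
  shows "convex_on S q \<longleftrightarrow> (\<forall>x\<in>S. 0 \<le> q x)"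
proof
  assume c: "convex_on S q"
  show "\<forall>x\<in>S. 0 \<le> q x"
  proof
    fix x assume x: "x \<in> S"
    have S0: "0 \<in> S" using S by (rule subspace_0)
    have "q ((1/2) *\<^sub>R x + (1/2) *\<^sub>R 0) \<le> 1/2 * q x + 1/2 * q 0"
      using c x S0 unfolding convex_on_def by (metis field_sum_of_halves zero_le_divide_1_iff zero_le_numeral)
    moreover have "q ((1/2) *\<^sub>R x + (1/2) *\<^sub>R 0) = 1/2 * q x + 1/2 * q 0 - 1/2 * (1/2) * q (x - 0)"
      using q x S0 unfolding quadratic_defect_def by (metis field_sum_of_halves)
    ultimately show "0 \<le> q x" by simp
  qed
next
  assume nn: "\<forall>x\<in>S. 0 \<le> q x"
  show "convex_on S q"
    unfolding convex_on_def
  proof (intro conjI ballI allI impI)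
    show "convex S" using S by (rule subspace_imp_convex)
    fix x y u v assume *: "x \<in> S" "y \<in> S" "0 \<le> u" "0 \<le> v" "u + v = (1::real)"
    have "0 \<le> u * v * q (x - y)"
      using * nn subspace_diff[OF S] by simp
    then show "q (u *\<^sub>R x + v *\<^sub>R y) \<le> u * q x + v * q y"
      using q * unfolding quadratic_defect_def by simp
  qed
qed

lemma strictly_convex_on_if_pos:
  assumes S: "subspace S" and q: "quadratic_defect S q"
    and pos: "\<And>x. x \<in> S \<Longrightarrow> x \<noteq> 0 \<Longrightarrow> 0 < q x"
  shows "strictly_convex_on S q"
  unfolding strictly_convex_on_def
proof (intro conjI ballI allI impI)
  show "convex S" using S by (rule subspace_imp_convex)
  fix x y u v assume *: "x \<in> S" "y \<in> S" "0 < u" "0 < v" "u + v = (1::real)" "x \<noteq> y"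
  have "0 < u * v * q (x - y)"
    using * pos subspace_diff[OF S] by simp
  then show "q (u *\<^sub>R x + v *\<^sub>R y) < u * q x + v * q y"
    using q * unfolding quadratic_defect_def by simp
qed

section \<open>The cost as a quadratic function on tuples\<close>

lemma kernel_form_add_left:
  "kernel_form H N t (\<lambda>i. x i + x' i) y = kernel_form H N t x y + kernel_form H N t x' y"
  by (simp add: kernel_form_def inner_add_left sum.distrib)

lemma kernel_form_add_right:
  "kernel_form H N t x (\<lambda>i. y i + y' i) = kernel_form H N t x y + kernel_form H N t x y'"
  by (simp add: kernel_form_def matrix_vector_right_distrib inner_add_right sum.distrib)

lemma kernel_form_scaleR_left:
  "kernel_form H N t (\<lambda>i. c *\<^sub>R x i) y = c * kernel_form H N t x y"
  by (simp add: kernel_form_def sum_distrib_left)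

lemma kernel_form_scaleR_right:
  "kernel_form H N t x (\<lambda>i. c *\<^sub>R y i) = c * kernel_form H N t x y"
  by (simp add: kernel_form_def matrix_vector_mult_scaleR sum_distrib_left)

lemma cost_eq_kernel_form:
  "cost G \<T> \<xi> = kernel_form (kernel_ext G) (card \<T>) (grid_point \<T>)
    (Poly_Mapping.lookup \<xi>) (Poly_Mapping.lookup \<xi>) / 2"
  by (simp add: cost_def kernel_form_def)

lemma lookup_scaleR: "Poly_Mapping.lookup (c *\<^sub>R \<xi>) k = c *\<^sub>R Poly_Mapping.lookup \<xi> k"
  by (simp add: scaleR_poly_mapping_def)

lemma quadratic_defect_cost: "quadratic_defect S (cost G \<T>)"
  unfolding quadratic_defect_def
proof (intro ballI allI impI)
  fix \<xi> \<zeta> :: "nat \<Rightarrow>\<^sub>0 real^'a" and u v :: real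
  assume uv: "u + v = 1"
  define B where "B = kernel_form (kernel_ext G) (card \<T>) (grid_point \<T>)"
  define x y where "x = Poly_Mapping.lookup \<xi>" and "y = Poly_Mapping.lookup \<zeta>"
  have lookup: "Poly_Mapping.lookup (a *\<^sub>R \<xi> + b *\<^sub>R \<zeta>) = (\<lambda>k. a *\<^sub>R x k + b *\<^sub>R y k)" for a b
    by (rule ext) (simp add: lookup_add lookup_scaleR x_def y_def)
  \<comment> \<open>One expansion with free coefficients serves all four costs in the identity:
    \<open>(1, 0)\<close>, \<open>(0, 1)\<close> and \<open>(1, - 1)\<close> give those of \<xi>,
    \<zeta> and their difference, and \<open>(u, v)\<close> gives the convex combination.\<close>
  have q: "cost G \<T> (a *\<^sub>R \<xi> + b *\<^sub>R \<zeta>) =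
      (a * a * B x x + a * b * (B x y + B y x) + b * b * B y y) / 2" for a b
    by (simp add: cost_eq_kernel_form lookup kernel_form_add_left
        kernel_form_add_right kernel_form_scaleR_left kernel_form_scaleR_right B_def
        algebra_simps)
  have q': "cost G \<T> \<xi> = B x x / 2" "cost G \<T> \<zeta> = B y y / 2"
    "cost G \<T> (\<xi> - \<zeta>) = (B x x - (B x y + B y x) + B y y) / 2"
    using q[of 1 0] q[of 0 1] q[of 1 "- 1"] by simp_all
  have v: "v = 1 - u" using uv by simp
  show "cost G \<T> (u *\<^sub>R \<xi> + v *\<^sub>R \<zeta>) = u * cost G \<T> \<xi> + v * cost G \<T> \<zeta> - u * v * cost G \<T> (\<xi> - \<zeta>)"
    unfolding q q' v by (simp add: field_simps)
qed

lemma subspace_tuples: "subspace (tuples N)"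
proof -
  \<comment> \<open>Vanishing of coordinates, unlike a bound on the set of keys, is visibly a linear
    condition.\<close>
  have "tuples N = {\<xi>. \<forall>k\<ge>N. Poly_Mapping.lookup \<xi> k = 0}"
    by (auto simp: tuples_def subset_iff in_keys_iff not_le[symmetric])
  then show ?thesis
    by (auto simp: subspace_def lookup_add lookup_scaleR)
qed

section \<open>Symmetry of the extension and the Hermitian form\<close>

lemma kernel_ext_minus: "kernel_ext G (- t) = transpose (kernel_ext G t)"
proof -
  \<comment> \<open>This is the case \<open>t = 0\<close>: the value there is symmetrized, hence
    equal to its own transpose.\<close>
  have "transpose ((1/2) *\<^sub>R (transpose A + A)) = (1/2) *\<^sub>R (transpose A + A)" for A :: "real^'a^'a"
    by (simp add: vec_eq_iff transpose_def)
  then show ?thesis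
    by (simp add: kernel_ext_def)
qed

text \<open>Exchanging two points transposes the matrix, which moves it to the other factor of the
  inner product; exchanging the summation indices does the rest.\<close>

lemma kernel_form_commute:
  assumes "\<And>t. H (- t) = transpose (H t)"
  shows "kernel_form H N t x y = kernel_form H N t y x"
proof -
  have "x i \<bullet> (H (t i - t j) *v y j) = y j \<bullet> (H (t j - t i) *v x i)" for i j
  proof -
    have "x i \<bullet> (H (t i - t j) *v y j) = (transpose (H (t i - t j)) *v x i) \<bullet> y j"
      by (simp only: transpose_matrix_vector dot_lmul_matrix)
    then show ?thesis
      using assms[of "t i - t j"] by (simp add: inner_commute)
  qed
  then show ?thesis
    unfolding kernel_form_def by (subst sum.swap) simp
qed

definition Re_vec :: "complex^'k \<Rightarrow> real^'k" where "Re_vec z = (\<chi> a. Re (z $ a))"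
definition Im_vec :: "complex^'k \<Rightarrow> real^'k" where "Im_vec z = (\<chi> a. Im (z $ a))"

lemma herm_prod_of_real:
  "herm_prod z (map_matrix complex_of_real A) w =
    Complex (Re_vec z \<bullet> (A *v Re_vec w) + Im_vec z \<bullet> (A *v Im_vec w))
            (Re_vec z \<bullet> (A *v Im_vec w) - Im_vec z \<bullet> (A *v Re_vec w))"
  by (rule complex_eqI)
    (simp_all add: herm_prod_def Re_vec_def Im_vec_def inner_vec_def matrix_vector_mult_def
      map_matrix_def sum.distrib sum_subtractf)

text \<open>Summed over all pairs, the imaginary part is the real form at (\<open>Re_vec\<close>,
  \<open>Im_vec\<close>) minus the one at (\<open>Im_vec\<close>, \<open>Re_vec\<close>), and these
  agree by symmetry.\<close>

lemma hermitian_form_eq: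
  assumes "\<And>t. H (- t) = transpose (H t)"
  shows "(\<Sum>i<N. \<Sum>j<N. herm_prod (z i) (complexify H (t i - t j)) (z j)) =
    complex_of_real (kernel_form H N t (\<lambda>i. Re_vec (z i)) (\<lambda>i. Re_vec (z i)) +
      kernel_form H N t (\<lambda>i. Im_vec (z i)) (\<lambda>i. Im_vec (z i)))"
  using kernel_form_commute[where H = H, OF assms, of N t "\<lambda>i. Re_vec (z i)" "\<lambda>i. Im_vec (z i)"]
  by (intro complex_eqI)
    (simp_all add: complexify_def herm_prod_of_real kernel_form_def sum.distrib sum_subtractf)

section \<open>Reduction of arbitrary points to a grid\<close>

lemma kernel_form_merge:
  assumes p: "\<And>i. i < N \<Longrightarrow> p i < n" and t: "\<And>i j. i < N \<Longrightarrow> j < N \<Longrightarrow> s (p i) - s (p j) = t i - t j"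
  shows "kernel_form H n s (\<lambda>k. \<Sum>i<N. if p i = k then x i else 0) (\<lambda>k. \<Sum>i<N. if p i = k then y i else 0)
    = kernel_form H N t x y"
proof -
  \<comment> \<open>Bilinearity expands the merged form into these summands. For fixed
    \<open>i\<close> and \<open>j\<close> only \<open>k = p i\<close>, \<open>l = p j\<close>
    survives, and there the difference of the new points equals \<open>t i - t j\<close>; a common
    translation is therefore harmless.\<close>
  let ?a = "\<lambda>k l i j. if p i = k then if p j = l then x i \<bullet> (H (s k - s l) *v y j) else 0 else 0"
  have bilinear_sum: "(\<Sum>i<N. f i) \<bullet> (A *v (\<Sum>j<N. g j)) = (\<Sum>i<N. \<Sum>j<N. f i \<bullet> (A *v g j))"
    for A :: "real^'a^'a" and f g
    by (simp only: inner_sum_left inner_sum_right linear_sum[OF matrix_vector_mul_linear]) (rule sum.swap)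
  have "kernel_form H n s (\<lambda>k. \<Sum>i<N. if p i = k then x i else 0) (\<lambda>k. \<Sum>i<N. if p i = k then y i else 0)
    = (\<Sum>k<n. \<Sum>l<n. \<Sum>i<N. \<Sum>j<N. ?a k l i j)"
    unfolding kernel_form_def bilinear_sum by (intro sum.cong refl) simp
  also have "\<dots> = (\<Sum>i<N. \<Sum>j<N. \<Sum>k<n. \<Sum>l<n. ?a k l i j)"
    \<comment> \<open>With the ranges fixed, the exchange moves sums over \<open>{..<N}\<close>
      outward past those over \<open>{..<n}\<close>.\<close>
    by (simp only: sum.swap[where A = "{..<n}" and B = "{..<N}"])
  also have "\<dots> = kernel_form H N t x y"
    unfolding kernel_form_def
  proof (intro sum.cong refl)
    fix i j assume "i \<in> {..<N}" "j \<in> {..<N}"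
    then have ij: "i < N" "j < N" by auto
    \<comment> \<open>The condition on \<open>k\<close> is pulled out of the sum over
      \<open>l\<close>, so that each sum collapses to a single index.\<close>
    have "(\<Sum>k<n. \<Sum>l<n. ?a k l i j) = (\<Sum>k<n. if p i = k then \<Sum>l<n. if p j = l then x i \<bullet> (H (s k - s l) *v y j) else 0 else 0)"
      by (intro sum.cong refl) auto
    also have "\<dots> = x i \<bullet> (H (t i - t j) *v y j)"
      using p[of i] p[of j] t[of i j] ij by simp
    finally show "(\<Sum>k<n. \<Sum>l<n. ?a k l i j) = x i \<bullet> (H (t i - t j) *v y j)" .
  qed
  finally show ?thesis .
qed

lemma grid_point_surj:
  assumes "finite \<T>" "s \<in> \<T>"
  shows "\<exists>k<card \<T>. grid_point \<T> k = s"
  using assms by (metis grid_point_def in_set_conv_nth length_sorted_list_of_set set_sorted_list_of_set)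

lemma inj_on_grid_point: "finite \<T> \<Longrightarrow> inj_on (grid_point \<T>) {..<card \<T>}"
  by (auto simp: inj_on_def grid_point_def nth_eq_iff_index_eq)

text \<open>Every real form of the extension is thus twice a cost on some grid. The last clause
  serves strict definiteness: at distinct points nothing is merged, so no cancellation can hide a
  nonzero vector.\<close>

lemma kernel_form_eq_cost:
  fixes x :: "nat \<Rightarrow> real^'k"
  obtains \<T> \<xi> where "time_grid \<T>" "\<xi> \<in> tuples (card \<T>)"
    "kernel_form (kernel_ext G) N t x x = 2 * cost G \<T> \<xi>"
    "inj_on t {..<N} \<Longrightarrow> \<xi> = 0 \<Longrightarrow> \<forall>i<N. x i = 0"
proof -
  \<comment> \<open>Subtracting this lower bound makes all points nonnegative; inserting
    \<open>0\<close> keeps the set nonempty when \<open>N = 0\<close>.\<close>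
  define m where "m = Min (insert 0 (t ` {..<N}))"
  define \<T> where "\<T> = insert 0 ((\<lambda>i. t i - m) ` {..<N})"
  have m: "m \<le> t i" if "i < N" for i
    unfolding m_def using that by (intro Min_le) auto
  have fin: "finite \<T>" and grid: "time_grid \<T>"
    using m by (auto simp: time_grid_def \<T>_def)
  have "\<exists>k<card \<T>. grid_point \<T> k = t i - m" if "i < N" for i
    using that by (intro grid_point_surj fin) (auto simp: \<T>_def)
  then obtain p where p: "\<And>i. i < N \<Longrightarrow> p i < card \<T>" "\<And>i. i < N \<Longrightarrow> grid_point \<T> (p i) = t i - m"
    by metis
  define \<xi> where "\<xi> = (\<Sum>i<N. Poly_Mapping.single (p i) (x i))"
  have lookup: "Poly_Mapping.lookup \<xi> k = (\<Sum>i<N. if p i = k then x i else 0)" for k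
    by (simp add: \<xi>_def lookup_sum lookup_single when_def)
  have "\<xi> \<in> tuples (card \<T>)"
    unfolding \<xi>_def by (intro subspace_sum[OF subspace_tuples]) (use p in \<open>auto simp: tuples_def\<close>)
  moreover have "kernel_form (kernel_ext G) N t x x = 2 * cost G \<T> \<xi>"
    using kernel_form_merge[of N p "card \<T>" "grid_point \<T>" t "kernel_ext G" x x] p
    by (simp add: cost_eq_kernel_form lookup[abs_def])
  moreover have "\<forall>i<N. x i = 0" if inj: "inj_on t {..<N}" and 0: "\<xi> = 0"
  proof (intro allI impI)
    fix i assume i: "i < N"
    \<comment> \<open>Distinct points have distinct grid indices, so coordinate \<open>p i\<close>
      of \<xi> is \<open>x i\<close> alone.\<close>
    have "p j = p i \<longleftrightarrow> j = i" if "j < N" for j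
      using p(2)[OF i] p(2)[OF that] inj i that by (auto simp: inj_on_def)
    then have "(\<Sum>j<N. if p j = p i then x j else 0) = (\<Sum>j<N. if j = i then x j else 0)"
      by (intro sum.cong) auto
    then show "x i = 0"
      using lookup[of "p i"] 0 i by simp
  qed
  ultimately show thesis
    using that grid by blast
qed

section \<open>Definiteness of the extension in terms of the cost\<close>

definition vec_of_real :: "real^'k \<Rightarrow> complex^'k"
  where "vec_of_real x = (\<chi> a. complex_of_real (x $ a))"

lemma Re_Im_vec_of_real [simp]: "Re_vec (vec_of_real x) = x" "Im_vec (vec_of_real x) = 0"
  by (simp_all add: Re_vec_def Im_vec_def vec_of_real_def vec_eq_iff)

lemma Re_Im_vec_eq_0: "Re_vec z = 0 \<Longrightarrow> Im_vec z = 0 \<Longrightarrow> z = 0"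
  by (simp add: Re_vec_def Im_vec_def vec_eq_iff complex_eq_iff)

text \<open>For real vectors only the form at the real parts remains. This carries definiteness of
  the extension over to costs, by sampling it at the grid points.\<close>

lemma hermitian_form_eq_cost:
  fixes \<xi> :: "nat \<Rightarrow>\<^sub>0 real^'k" and G \<T>
  defines "z \<equiv> \<lambda>i. vec_of_real (Poly_Mapping.lookup \<xi> i)"
  shows "(\<Sum>i<card \<T>. \<Sum>j<card \<T>. herm_prod (z i)
      (complexify (kernel_ext G) (grid_point \<T> i - grid_point \<T> j)) (z j)) =
    complex_of_real (2 * cost G \<T> \<xi>)"
proof -
  have "kernel_form H N t (\<lambda>i. 0) (\<lambda>i. 0) = 0" for H :: "real \<Rightarrow> real^'k^'k" and N t
    by (simp add: kernel_form_def)
  then show ?thesis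
    by (simp add: hermitian_form_eq[where H = "kernel_ext G", OF kernel_ext_minus] cost_eq_kernel_form z_def)
qed

lemma kernel_form_nonneg:
  assumes "\<And>\<T> \<xi>. time_grid \<T> \<Longrightarrow> \<xi> \<in> tuples (card \<T>) \<Longrightarrow> 0 \<le> cost G \<T> \<xi>"
  shows "0 \<le> kernel_form (kernel_ext G) N t x x"
  using assms by (metis kernel_form_eq_cost mult_nonneg_nonneg zero_le_numeral)

text \<open>Forwards, the Hermitian form is tested at grid points with real vectors. Backwards, it
  is a sum of two real forms, each of them twice a cost.\<close>

lemma pos_def_iff_cost_nonneg:
  "pos_def_matrix_fun (complexify (kernel_ext G)) \<longleftrightarrow>
    (\<forall>\<T>. time_grid \<T> \<longrightarrow> (\<forall>\<xi>\<in>tuples (card \<T>). 0 \<le> cost G \<T> \<xi>))" (is "?L \<longleftrightarrow> ?R")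
proof
  assume L: ?L
  show ?R
  proof (intro allI impI ballI)
    fix \<T> and \<xi> :: "nat \<Rightarrow>\<^sub>0 real^'a"
    have "complex_of_real (2 * cost G \<T> \<xi>) \<in> \<real>\<^sub>\<ge>\<^sub>0"
      unfolding hermitian_form_eq_cost[symmetric]
      by (rule L[unfolded pos_def_matrix_fun_def, rule_format])
    then show "0 \<le> cost G \<T> \<xi>"
      by (simp only: nonneg_Reals_of_real_iff)
  qed
next
  assume R: ?R
  then have "0 \<le> kernel_form (kernel_ext G) N t x x" for N t x
    by (intro kernel_form_nonneg) blast
  then show ?L
    unfolding pos_def_matrix_fun_def hermitian_form_eq[where H = "kernel_ext G", OF kernel_ext_minus]
    by (simp only: nonneg_Reals_of_real_iff) simp
qed

lemma strictly_pos_def_iff_cost_eq_0: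
  assumes pd: "pos_def_matrix_fun (complexify (kernel_ext G))"
  shows "strictly_pos_def_matrix_fun (complexify (kernel_ext G)) \<longleftrightarrow>
    (\<forall>\<T>. time_grid \<T> \<longrightarrow> (\<forall>\<xi>\<in>tuples (card \<T>). cost G \<T> \<xi> = 0 \<longrightarrow> \<xi> = 0))" (is "?L \<longleftrightarrow> ?R")
proof
  assume L: ?L
  show ?R
  proof (intro allI impI ballI)
    fix \<T> and \<xi> :: "nat \<Rightarrow>\<^sub>0 real^'a"
    assume grid: "time_grid \<T>" and \<xi>: "\<xi> \<in> tuples (card \<T>)" and 0: "cost G \<T> \<xi> = 0"
    \<comment> \<open>Strict definiteness speaks only of pairwise distinct points, which grid points
      are.\<close>
    have "inj_on (grid_point \<T>) {..<card \<T>}"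
      using grid by (intro inj_on_grid_point) (simp add: time_grid_def)
    then have *: "\<forall>i<card \<T>. vec_of_real (Poly_Mapping.lookup \<xi> i) = 0"
      using L hermitian_form_eq_cost[of \<xi> G \<T>] 0 unfolding strictly_pos_def_matrix_fun_def by force
    have "Poly_Mapping.lookup \<xi> i = 0" if "i < card \<T>" for i
      using *[rule_format, OF that] by (simp add: vec_of_real_def vec_eq_iff)
    moreover have "Poly_Mapping.lookup \<xi> i = 0" if "\<not> i < card \<T>" for i
      using \<xi> that by (auto simp: tuples_def subset_iff in_keys_iff)
    ultimately show "\<xi> = 0"
      by (intro poly_mapping_eqI) auto
  qed
next
  assume R: ?R
  show ?L
    unfolding strictly_pos_def_matrix_fun_def
  proof (intro conjI allI impI)
    show "pos_def_matrix_fun (complexify (kernel_ext G))" by fact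
    fix N i and t :: "nat \<Rightarrow> real" and z :: "nat \<Rightarrow> complex^'a"
    assume inj: "inj_on t {..<N}" and i: "i < N"
      and sum0: "(\<Sum>i<N. \<Sum>j<N. herm_prod (z i) (complexify (kernel_ext G) (t i - t j)) (z j)) = 0"
    let ?q = "\<lambda>x. kernel_form (kernel_ext G) N t x x"
    have nonneg: "0 \<le> ?q x" for x
      using pd by (intro kernel_form_nonneg) (simp add: pos_def_iff_cost_nonneg)
    \<comment> \<open>The reduction to a grid turns a vanishing real form into a vanishing cost,
      hence a zero tuple; injectivity of \<open>t\<close> then recovers
      \<open>x i = 0\<close>.\<close>
    have zero: "x i = 0" if "?q x = 0" for x
    proof -
      obtain \<T> \<xi> where "time_grid \<T>" "\<xi> \<in> tuples (card \<T>)" "?q x = 2 * cost G \<T> \<xi>"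
        "inj_on t {..<N} \<Longrightarrow> \<xi> = 0 \<Longrightarrow> \<forall>i<N. x i = 0"
        using kernel_form_eq_cost[of G N t x] by blast
      with R inj i that show ?thesis by auto
    qed
    have "?q (\<lambda>i. Re_vec (z i)) + ?q (\<lambda>i. Im_vec (z i)) = 0"
      using sum0 unfolding hermitian_form_eq[where H = "kernel_ext G", OF kernel_ext_minus] of_real_eq_0_iff .
    \<comment> \<open>Positive definiteness enters here: two nonnegative numbers with sum zero both
      vanish.\<close>
    then have "?q (\<lambda>i. Re_vec (z i)) = 0" "?q (\<lambda>i. Im_vec (z i)) = 0"
      using nonneg[of "\<lambda>i. Re_vec (z i)"] nonneg[of "\<lambda>i. Im_vec (z i)"] by linarith+
    then show "z i = 0"
      using zero by (intro Re_Im_vec_eq_0) blast+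
  qed
qed

section \<open>Deterministic strategies and expected cost\<close>

lemma const_admissible:
  fixes \<xi> :: "nat \<Rightarrow>\<^sub>0 real^'k"
  assumes "\<xi> \<in> tuples (card \<T>)"
  shows "(\<lambda>_. \<xi>) \<in> admissible M T F \<T> (- (\<Sum>k<card \<T>. Poly_Mapping.lookup \<xi> k))"
  \<comment> \<open>A constant is bounded and measurable for every sigma-algebra, and the initial
    portfolio is chosen to cancel its total.\<close>
  using assms by (auto simp: admissible_def intro: bounded_subset[OF bounded_insert[THEN iffD2, OF bounded_empty]])

lemma expected_cost_nonneg_iff:
  fixes G :: "real \<Rightarrow> real^'k^'k"
  assumes "prob_space M"
  shows "(\<forall>\<T> X0 \<eta>. time_grid \<T> \<longrightarrow> \<eta> \<in> admissible M T F \<T> X0 \<longrightarrow> 0 \<le> (\<integral>\<omega>. cost G \<T> (\<eta> \<omega>) \<partial>M))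
    \<longleftrightarrow> (\<forall>\<T>. time_grid \<T> \<longrightarrow> (\<forall>\<xi>\<in>tuples (card \<T>). 0 \<le> cost G \<T> \<xi>))" (is "?L \<longleftrightarrow> ?R")
proof
  interpret prob_space M by fact
  assume L: ?L
  show ?R
  proof (intro allI impI ballI)
    fix \<T> and \<xi> :: "nat \<Rightarrow>\<^sub>0 real^'k"
    assume "time_grid \<T>" "\<xi> \<in> tuples (card \<T>)"
    then have "0 \<le> (\<integral>\<omega>. cost G \<T> \<xi> \<partial>M)"
      using L const_admissible by blast
    \<comment> \<open>The total mass is one, so the expected cost of a constant strategy is its
      cost.\<close>
    then show "0 \<le> cost G \<T> \<xi>"
      by (simp add: prob_space)
  qed
next
  assume ?R
  then show ?L
    \<comment> \<open>An admissible strategy takes a tuple as value at each outcome in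
      \<open>space M\<close>, so the integrand is nonnegative pointwise.\<close>
    by (auto simp: admissible_def intro!: integral_nonneg)
qed

theorem proposition2p6:
  fixes G :: "real \<Rightarrow> real^'k^'k"
    and M :: "'w measure" and T :: real and F :: "real \<Rightarrow> 'w measure"
  assumes "filtered_prob_space M T F"
    and "decay_kernel G"
  shows
    "((\<forall>\<T> X0 \<eta>. time_grid \<T> \<longrightarrow> \<eta> \<in> admissible M T F \<T> X0 \<longrightarrow>
         (\<integral>\<omega>. cost G \<T> (\<eta> \<omega>) \<partial>M) \<ge> 0)
      \<longleftrightarrow> (\<forall>\<T>. time_grid \<T> \<longrightarrow> (\<forall>\<xi>\<in>tuples (card \<T>). cost G \<T> \<xi> \<ge> 0)))
     \<and> ((\<forall>\<T>. time_grid \<T> \<longrightarrow> (\<forall>\<xi>\<in>tuples (card \<T>). cost G \<T> \<xi> \<ge> 0))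
      \<longleftrightarrow> (\<forall>\<T>. time_grid \<T> \<longrightarrow> convex_on (tuples (card \<T>)) (cost G \<T>)))
     \<and> ((\<forall>\<T>. time_grid \<T> \<longrightarrow> convex_on (tuples (card \<T>)) (cost G \<T>))
      \<longleftrightarrow> pos_def_matrix_fun (complexify (kernel_ext G)))
     \<and> (pos_def_matrix_fun (complexify (kernel_ext G)) \<longrightarrow>
         ((\<forall>\<T>. time_grid \<T> \<longrightarrow> (\<forall>\<xi>\<in>tuples (card \<T>). cost G \<T> \<xi> = 0 \<longrightarrow> \<xi> = 0))
           \<longleftrightarrow> strictly_pos_def_matrix_fun (complexify (kernel_ext G)))
         \<and> (strictly_pos_def_matrix_fun (complexify (kernel_ext G)) \<longrightarrow>
             (\<forall>\<T>. time_grid \<T> \<longrightarrow> strictly_convex_on (tuples (card \<T>)) (cost G \<T>))))"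
proof -
  have prob: "prob_space M"
    using assms(1) by (simp add: filtered_prob_space_def)
  have convex: "convex_on (tuples (card \<T>)) (cost G \<T>) \<longleftrightarrow> (\<forall>\<xi>\<in>tuples (card \<T>). 0 \<le> cost G \<T> \<xi>)" for \<T>
    by (intro convex_on_iff_nonneg subspace_tuples quadratic_defect_cost)
  have "strictly_convex_on (tuples (card \<T>)) (cost G \<T>)"
    if spd: "strictly_pos_def_matrix_fun (complexify (kernel_ext G))" and grid: "time_grid \<T>" for \<T>
  proof (intro strictly_convex_on_if_pos subspace_tuples quadratic_defect_cost)
    fix \<xi> :: "nat \<Rightarrow>\<^sub>0 real^'k"
    assume \<xi>: "\<xi> \<in> tuples (card \<T>)" "\<xi> \<noteq> 0"
    have pd: "pos_def_matrix_fun (complexify (kernel_ext G))"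
      using spd by (simp add: strictly_pos_def_matrix_fun_def)
    \<comment> \<open>Negative cost is excluded by positive definiteness, zero cost at a nonzero
      tuple by strictness.\<close>
    have "0 \<le> cost G \<T> \<xi>"
      using pd grid \<xi> by (simp add: pos_def_iff_cost_nonneg)
    moreover have "cost G \<T> \<xi> \<noteq> 0"
      using spd grid \<xi> strictly_pos_def_iff_cost_eq_0[OF pd] by blast
    ultimately show "0 < cost G \<T> \<xi>" by simp
  qed
  \<comment> \<open>Conditions (a), (b) and (c) are all rewritten into (d), so the equivalences
    become trivial.\<close>
  then show ?thesis
    unfolding convex expected_cost_nonneg_iff[OF prob] pos_def_iff_cost_nonneg[symmetric]
    by (simp add: strictly_pos_def_iff_cost_eq_0[symmetric])
qed

end
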